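(* Let $K\ge 2$, $Y=(Y_1,\dots,Y_K)'\in\mathbb{R}^K$, and $\sigma_1,\dots,\sigma_K>0$. For $r\ge 1$ consider the favored-design ratio class $\Lambda_r=\{\lambda\in\Delta(\mathcal{V}):\lambda_1\ge r\lambda_k\ \forall k\ne 1\}$, with worst-case posterior risk $R_r(a|Y)$ and optimal headline $\hat\theta_r^*(Y)$ (see context). Then $$\hat\theta_r^*(Y)=\arg\min_{a\in\mathbb{R}}R_r(a|Y),\qquad R_r(a|Y)=\max_{m\in\{0,\dots,K-1\}}\frac{rD_1(a|Y)^2+\sum_{j=1}^mD_{-1,(j)}(a|Y)^2}{r+m}+1,$$ where the inner sum is zero if $m=0$. For each $m$, the corresponding term in the maximum is generated by an extreme design prior (an extreme point of $\Lambda_r$) that places probability $r/(r+m)$ on design $1$ and probability $1/(r+m)$ on each of the $m$ alternatives $k\neq 1$ with the largest squared standardized discrepancies. With $R_r^*(Y)=R_r(\hat\theta_r^*(Y)|Y)$, the solution can be computed as $$\lambda_r^*\in\arg\max\{\rho(\lambda|Y):\lambda\in\Delta(\mathcal{V}),\ \lambda_1\ge r\lambda_k\ \forall k\ne 1\},\qquad \hat\theta_r^*(Y)=a(\lambda_r^*|Y),\qquad R_r^*(Y)=\rho(\lambda_r^*|Y)+1.$$ The optimized risk $R_r^*(Y)$ is nonincreasing in $r$ and, as $r\to\infty$, $$R_r^*(Y)\to 1,\qquad \hat\theta_r^*(Y)\to Y_1.$$ For $K=2$, let $p_r=r/(r+1)$, $p_\Delta=\sigma_1/(\sigma_1+\sigma_2)$,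 $\mathcal{I}_r=[p_r,1]$, and $p_r^*=\arg\min_{p\in\mathcal{I}_r}|p-p_\Delta|=\max\{p_\Delta,p_r\}$. In this case, $$\hat\theta_r^*(Y)=\frac{p_r^*Y_1/\sigma_1^2+(1-p_r^* )Y_2/\sigma_2^2}{p_r^*/\sigma_1^2+(1-p_r^* )/\sigma_2^2},\qquad R_r^*(Y)=\frac{p_r^*(1-p_r^* )(Y_1-Y_2)^2}{p_r^*\sigma_2^2+(1-p_r^* )\sigma_1^2}+1.$$ If $p_\Delta\in\mathcal{I}_r$, then $\hat\theta_r^*(Y)=\hat\theta_\Delta^*(Y)$. Equivalently, $\hat\theta_r^*(Y)=\hat\theta_\Delta^*(Y)$ if $r\le\sigma_1/\sigma_2$.
   Context: $\Delta(\mathcal{V})=\{\lambda\in\mathbb{R}^K:\lambda\ge 0,\ \sum_{k=1}^K\lambda_k=1\}$. Let $D_k(a|Y)=|Y_k-a|/\sigma_k$ for $a\in\mathbb{R}$ (standardized discrepancy), and let $D_{-1,(1)}(a|Y)^2\ge\cdots\ge D_{-1,(K-1)}(a|Y)^2$ denote a decreasing rearrangement of $\{D_k(a|Y)^2:k\ne 1\}$. For a nonempty, compact, convex class $\Lambda\subseteq\Delta(\mathcal{V})$, the worst-case posterior risk of $a$ is $R_\Lambda(a|Y)=\max_{\lambda\in\Lambda}\sum_{k=1}^K\lambda_kD_k(a|Y)^2+1$ and the optimal headline is its unique minimizer over $a\in\mathbb{R}$. $R_r(a|Y)$ and $\hat\theta_r^*(Y)$ denote these objects for $\Lambda=\Lambda_r$,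 and $\hat\theta_\Delta^*(Y)$ denotes the optimal headline for $\Lambda=\Delta(\mathcal{V})$. A term in the maximum is "generated by" a prior $\lambda$ if it equals $\sum_k\lambda_kD_k(a|Y)^2$. For $\lambda\in\Delta(\mathcal{V})$, $$a(\lambda|Y)=\frac{\sum_{k}\lambda_kY_k/\sigma_k^2}{\sum_{k}\lambda_k/\sigma_k^2},\qquad \rho(\lambda|Y)=\sum_{k}\lambda_kD_k(a(\lambda|Y)|Y)^2.$$ "The solution can be computed as" means that the displayed identities hold for any maximizer $\lambda_r^*$. *)

theory Defs
  imports "HOL-Analysis.Analysis"
begin

text \<open>
  The designs are the elements of a finite type \<open>'n\<close>, so \<open>K = CARD('n)\<close>. An arbitrary
  element \<open>d\<close> of \<open>'n\<close> plays the role of the favored design, design 1.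
\<close>

definition prob_simplex :: "(real^'n) set" where
  "prob_simplex = {l. (\<forall>k. 0 \<le> l $ k) \<and> (\<Sum>k\<in>UNIV. l $ k) = 1}"

definition std_disc :: "real^'n \<Rightarrow> real^'n \<Rightarrow> 'n \<Rightarrow> real \<Rightarrow> real" where
  "std_disc \<sigma> Y k a = \<bar>Y $ k - a\<bar> / \<sigma> $ k"

definition prior_loss :: "real^'n \<Rightarrow> real^'n \<Rightarrow> real^'n \<Rightarrow> real \<Rightarrow> real" where
  "prior_loss \<sigma> Y l a = (\<Sum>k\<in>UNIV. l $ k * (std_disc \<sigma> Y k a)\<^sup>2)"

text \<open>
  For nonempty compact classes the supremum is a maximum and the minimizer exists and is unique;
  see \<open>worst_case_risk_attained\<close> and \<open>optimal_headline_unique\<close> below.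
\<close>

definition worst_case_risk :: "real^'n \<Rightarrow> real^'n \<Rightarrow> (real^'n) set \<Rightarrow> real \<Rightarrow> real" where
  "worst_case_risk \<sigma> Y \<Lambda> a = (SUP l\<in>\<Lambda>. prior_loss \<sigma> Y l a) + 1"

definition optimal_headline :: "real^'n \<Rightarrow> real^'n \<Rightarrow> (real^'n) set \<Rightarrow> real" where
  "optimal_headline \<sigma> Y \<Lambda> = (THE a. is_arg_min (worst_case_risk \<sigma> Y \<Lambda>) (\<lambda>_. True) a)"

definition optimized_risk :: "real^'n \<Rightarrow> real^'n \<Rightarrow> (real^'n) set \<Rightarrow> real" where
  "optimized_risk \<sigma> Y \<Lambda> = worst_case_risk \<sigma> Y \<Lambda> (optimal_headline \<sigma> Y \<Lambda>)"

definition ratio_class :: "'n \<Rightarrow> real \<Rightarrow> (real^'n) set" where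
  "ratio_class d r = {l \<in> prob_simplex. \<forall>k. k \<noteq> d \<longrightarrow> l $ d \<ge> r * l $ k}"

text \<open>
  The \<open>j\<close>-th largest, counted with multiplicity and starting at \<open>j = 1\<close>, of the squared
  discrepancies of the designs other than \<open>d\<close>. Meaningful for \<open>1 \<le> j \<le> K - 1\<close> only.
\<close>

definition sq_disc_desc :: "real^'n \<Rightarrow> real^'n \<Rightarrow> 'n \<Rightarrow> real \<Rightarrow> nat \<Rightarrow> real" where
  "sq_disc_desc \<sigma> Y d a j =
     rev (sorted_list_of_multiset
            (image_mset (\<lambda>k. (std_disc \<sigma> Y k a)\<^sup>2) (mset_set (UNIV - {d})))) ! (j - 1)"

text \<open>With ties there may be several sets \<open>S\<close> of \<open>m\<close> alternatives with the largest discrepancies.\<close>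

definition top_alternatives ::
    "real^'n \<Rightarrow> real^'n \<Rightarrow> 'n \<Rightarrow> real \<Rightarrow> nat \<Rightarrow> 'n set \<Rightarrow> bool" where
  "top_alternatives \<sigma> Y d a m S \<longleftrightarrow>
     S \<subseteq> UNIV - {d} \<and> card S = m \<and>
     (\<forall>k\<in>S. \<forall>l\<in>UNIV - {d} - S. (std_disc \<sigma> Y l a)\<^sup>2 \<le> (std_disc \<sigma> Y k a)\<^sup>2)"

definition favored_prior :: "'n \<Rightarrow> real \<Rightarrow> nat \<Rightarrow> 'n set \<Rightarrow> real^'n" where
  "favored_prior d r m S =
     (\<chi> k. if k = d then r / (r + real m) else if k \<in> S then 1 / (r + real m) else 0)"

definition prior_headline :: "real^'n \<Rightarrow> real^'n \<Rightarrow> real^'n \<Rightarrow> real" where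
  "prior_headline \<sigma> Y l =
     (\<Sum>k\<in>UNIV. l $ k * Y $ k / (\<sigma> $ k)\<^sup>2) / (\<Sum>k\<in>UNIV. l $ k / (\<sigma> $ k)\<^sup>2)"

definition prior_value :: "real^'n \<Rightarrow> real^'n \<Rightarrow> real^'n \<Rightarrow> real" where
  "prior_value \<sigma> Y l = prior_loss \<sigma> Y l (prior_headline \<sigma> Y l)"


lemma convex_prob_simplex: "convex (prob_simplex :: (real^'n) set)"
  unfolding convex_def prob_simplex_def
  by (auto simp: sum.distrib simp flip: sum_distrib_left)

lemma compact_prob_simplex: "compact (prob_simplex :: (real^'n) set)"
proof -
  have "closed ((\<Inter>k. {l :: real^'n. 0 \<le> l $ k}) \<inter> {l. (\<Sum>k\<in>UNIV. l $ k) = 1})"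
    by (intro closed_Int closed_INT ballI closed_Collect_le closed_Collect_eq continuous_intros)
  moreover have "(\<Inter>k. {l :: real^'n. 0 \<le> l $ k}) \<inter> {l. (\<Sum>k\<in>UNIV. l $ k) = 1} = prob_simplex"
    by (auto simp: prob_simplex_def)
  moreover have "norm l \<le> 1" if "l \<in> prob_simplex" for l :: "real^'n"
    using norm_le_l1_cart[of l] that by (simp add: prob_simplex_def)
  then have "bounded (prob_simplex :: (real^'n) set)"
    using bounded_iff by blast
  ultimately show ?thesis
    by (simp add: compact_eq_bounded_closed)
qed

lemma convex_ratio_class: "convex (ratio_class d r)"
proof (rule convexI)
  fix x y and u v :: real
  assume xy: "x \<in> ratio_class d r" "y \<in> ratio_class d r" and uv: "0 \<le> u" "0 \<le> v" "u + v = 1"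
  have "u *\<^sub>R x + v *\<^sub>R y \<in> prob_simplex"
    using xy uv convex_prob_simplex by (auto simp: ratio_class_def convex_def)
  moreover have "r * (u * x $ k + v * y $ k) \<le> u * x $ d + v * y $ d" if "k \<noteq> d" for k
  proof -
    have "u * (r * x $ k) + v * (r * y $ k) \<le> u * x $ d + v * y $ d"
      using xy uv that by (intro add_mono mult_left_mono) (auto simp: ratio_class_def)
    then show ?thesis by (simp add: algebra_simps)
  qed
  ultimately show "u *\<^sub>R x + v *\<^sub>R y \<in> ratio_class d r"
    by (simp add: ratio_class_def)
qed

lemma compact_ratio_class: "compact (ratio_class d r)"
proof -
  have "closed (\<Inter>k\<in>UNIV - {d}. {l :: real^'a. r * l $ k \<le> l $ d})"
    by (intro closed_INT ballI closed_Collect_le continuous_intros)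
  moreover have "ratio_class d r = prob_simplex \<inter> (\<Inter>k\<in>UNIV - {d}. {l. r * l $ k \<le> l $ d})"
    by (auto simp: ratio_class_def)
  ultimately show ?thesis
    by (simp add: compact_Int_closed compact_prob_simplex)
qed

lemma axis_in_ratio_class: "axis d 1 \<in> ratio_class d r"
  by (auto simp: ratio_class_def prob_simplex_def axis_def)

lemma ratio_class_subset: "ratio_class d r \<subseteq> prob_simplex"
  by (auto simp: ratio_class_def)

lemma worst_case_risk_attained:
  assumes "compact \<Lambda>" "\<Lambda> \<noteq> {}"
  obtains l where "l \<in> \<Lambda>" "worst_case_risk \<sigma> Y \<Lambda> a = prior_loss \<sigma> Y l a + 1"
    "\<And>l'. l' \<in> \<Lambda> \<Longrightarrow> prior_loss \<sigma> Y l' a \<le> prior_loss \<sigma> Y l a"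
proof -
  have "continuous_on \<Lambda> (\<lambda>l. prior_loss \<sigma> Y l a)"
    unfolding prior_loss_def by (intro continuous_intros)
  then obtain l where l: "l \<in> \<Lambda>" "\<forall>l'\<in>\<Lambda>. prior_loss \<sigma> Y l' a \<le> prior_loss \<sigma> Y l a"
    using continuous_attains_sup[OF assms] by blast
  have "(SUP l\<in>\<Lambda>. prior_loss \<sigma> Y l a) = prior_loss \<sigma> Y l a"
    using l by (intro cSup_eq_maximum) auto
  with l that show thesis
    unfolding worst_case_risk_def by auto
qed

lemma prior_loss_midpoint:
  assumes "l \<in> prob_simplex" "\<And>k. \<sigma> $ k > 0" "a \<noteq> b"
  shows "prior_loss \<sigma> Y l ((a + b) / 2) < (prior_loss \<sigma> Y l a + prior_loss \<sigma> Y l b) / 2"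
proof -
  have eq: "(std_disc \<sigma> Y k ((a + b) / 2))\<^sup>2 =
      ((std_disc \<sigma> Y k a)\<^sup>2 + (std_disc \<sigma> Y k b)\<^sup>2) / 2 - (a - b)\<^sup>2 / (4 * (\<sigma> $ k)\<^sup>2)" for k
    using assms(2)[of k] by (simp add: std_disc_def power_divide field_simps power2_eq_square)
  have lt: "(std_disc \<sigma> Y k ((a + b) / 2))\<^sup>2 < ((std_disc \<sigma> Y k a)\<^sup>2 + (std_disc \<sigma> Y k b)\<^sup>2) / 2" for k
  proof -
    have "0 < (a - b)\<^sup>2 / (4 * (\<sigma> $ k)\<^sup>2)"
      using assms(2)[of k] assms(3) by simp
    then show ?thesis unfolding eq by linarith
  qed
  have nn: "0 \<le> l $ k" for k
    using assms(1) by (simp add: prob_simplex_def)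
  have "(\<Sum>k\<in>UNIV. l $ k) \<noteq> 0"
    using assms(1) by (simp add: prob_simplex_def)
  then have "\<exists>k. l $ k \<noteq> 0"
    by (rule contrapos_np) simp
  then obtain k where "l $ k \<noteq> 0" by blast
  with nn[of k] have k: "l $ k > 0" by linarith
  have "prior_loss \<sigma> Y l ((a + b) / 2) <
      (\<Sum>k\<in>UNIV. l $ k * (((std_disc \<sigma> Y k a)\<^sup>2 + (std_disc \<sigma> Y k b)\<^sup>2) / 2))"
    unfolding prior_loss_def
  proof (rule sum_strict_mono_ex1)
    show "\<forall>k\<in>UNIV. l $ k * (std_disc \<sigma> Y k ((a + b) / 2))\<^sup>2
        \<le> l $ k * (((std_disc \<sigma> Y k a)\<^sup>2 + (std_disc \<sigma> Y k b)\<^sup>2) / 2)"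
      by (intro ballI mult_left_mono less_imp_le[OF lt] nn)
    show "\<exists>k\<in>UNIV. l $ k * (std_disc \<sigma> Y k ((a + b) / 2))\<^sup>2
        < l $ k * (((std_disc \<sigma> Y k a)\<^sup>2 + (std_disc \<sigma> Y k b)\<^sup>2) / 2)"
      using k lt by (intro bexI[of _ k] mult_strict_left_mono) auto
  qed simp
  also have "\<dots> = (prior_loss \<sigma> Y l a + prior_loss \<sigma> Y l b) / 2"
    by (simp add: prior_loss_def sum.distrib sum_divide_distrib distrib_left add_divide_distrib)
  finally show ?thesis .
qed

lemma optimal_headline_unique:
  assumes cpt: "compact \<Lambda>" and ne: "\<Lambda> \<noteq> {}" and sub: "\<Lambda> \<subseteq> prob_simplex"
    and pos: "\<And>k. \<sigma> $ k > 0"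
  shows "is_arg_min (worst_case_risk \<sigma> Y \<Lambda>) (\<lambda>_. True) a \<longleftrightarrow> a = optimal_headline \<sigma> Y \<Lambda>"
proof -
  let ?R = "worst_case_risk \<sigma> Y \<Lambda>"
  have upper: "prior_loss \<sigma> Y l a + 1 \<le> ?R a" if "l \<in> \<Lambda>" for l a
    by (rule worst_case_risk_attained[OF cpt ne, of \<sigma> Y a]) (use that in auto)
  have mid: "?R ((a + b) / 2) < (?R a + ?R b) / 2" if ab: "a \<noteq> b" for a b
  proof -
    obtain l where l: "l \<in> \<Lambda>" "?R ((a + b) / 2) = prior_loss \<sigma> Y l ((a + b) / 2) + 1"
      using worst_case_risk_attained[OF cpt ne] by blast
    have "l \<in> prob_simplex" using l(1) sub by blast
    from prior_loss_midpoint[OF this pos ab, of Y] upper[OF l(1), of a] upper[OF l(1), of b] l(2)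
    show ?thesis by argo
  qed
  have conv: "convex_on UNIV ?R"
  proof (rule convex_onI)
    fix t x y :: real assume t: "0 < t" "t < 1"
    let ?z = "(1 - t) *\<^sub>R x + t *\<^sub>R y"
    obtain l where l: "l \<in> \<Lambda>" "?R ?z = prior_loss \<sigma> Y l ?z + 1"
      using worst_case_risk_attained[OF cpt ne] by blast
    have sq: "(std_disc \<sigma> Y k ?z)\<^sup>2 \<le> (1 - t) * (std_disc \<sigma> Y k x)\<^sup>2 + t * (std_disc \<sigma> Y k y)\<^sup>2" for k
    proof -
      have "(1 - t) * (Y $ k - x)\<^sup>2 + t * (Y $ k - y)\<^sup>2 - (Y $ k - ?z)\<^sup>2 = t * (1 - t) * (x - y)\<^sup>2"
        by (simp add: power2_eq_square algebra_simps)
      then have "(1 - t) * (std_disc \<sigma> Y k x)\<^sup>2 + t * (std_disc \<sigma> Y k y)\<^sup>2 - (std_disc \<sigma> Y k ?z)\<^sup>2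
          = t * (1 - t) * (x - y)\<^sup>2 / (\<sigma> $ k)\<^sup>2"
        by (simp add: std_disc_def power_divide flip: add_divide_distrib diff_divide_distrib)
      moreover have "0 \<le> t * (1 - t) * (x - y)\<^sup>2 / (\<sigma> $ k)\<^sup>2"
        using t by simp
      ultimately show ?thesis by linarith
    qed
    have "prior_loss \<sigma> Y l ?z
        \<le> (\<Sum>k\<in>UNIV. l $ k * ((1 - t) * (std_disc \<sigma> Y k x)\<^sup>2 + t * (std_disc \<sigma> Y k y)\<^sup>2))"
      unfolding prior_loss_def using l(1) sub sq
      by (intro sum_mono mult_left_mono) (auto simp: prob_simplex_def)
    also have "\<dots> = (1 - t) * prior_loss \<sigma> Y l x + t * prior_loss \<sigma> Y l y"
      by (simp add: prior_loss_def sum_distrib_left sum.distrib distrib_left mult.left_commute)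
    finally have "?R ?z \<le> (1 - t) * (prior_loss \<sigma> Y l x + 1) + t * (prior_loss \<sigma> Y l y + 1)"
      using l(2) by (simp add: algebra_simps)
    also have "\<dots> \<le> (1 - t) * ?R x + t * ?R y"
      using t upper[OF l(1)] by (intro add_mono mult_left_mono) auto
    finally show "?R ?z \<le> (1 - t) * ?R x + t * ?R y" .
  qed auto
  define A where "A = Min (range (($) Y))"
  define B where "B = Max (range (($) Y))"
  have AB: "A \<le> Y $ k" "Y $ k \<le> B" for k
    unfolding A_def B_def by (auto intro: Min_le Max_ge)
  have "A \<le> B" using order_trans[OF AB(1) AB(2)] .
  have "continuous_on {A..B} ?R"
    by (rule continuous_on_subset[OF convex_on_continuous[OF open_UNIV conv]]) simp
  moreover have "{A..B} \<noteq> {}" using \<open>A \<le> B\<close> by simp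
  ultimately obtain c where c: "\<And>a. a \<in> {A..B} \<Longrightarrow> ?R c \<le> ?R a"
    using continuous_attains_inf[OF compact_Icc, of A B ?R] by blast
  have min_c: "?R c \<le> ?R a" for a
  proof -
    let ?a = "max A (min B a)"
    obtain l where l: "l \<in> \<Lambda>" "?R ?a = prior_loss \<sigma> Y l ?a + 1"
      using worst_case_risk_attained[OF cpt ne] by blast
    have "(std_disc \<sigma> Y k ?a)\<^sup>2 \<le> (std_disc \<sigma> Y k a)\<^sup>2" for k
    proof -
      have "\<bar>Y $ k - ?a\<bar> \<le> \<bar>Y $ k - a\<bar>"
        using AB[of k] by linarith
      then show ?thesis
        using pos[of k] unfolding std_disc_def by (intro power_mono divide_right_mono) auto
    qed
    then have "prior_loss \<sigma> Y l ?a \<le> prior_loss \<sigma> Y l a"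
      unfolding prior_loss_def using l(1) sub
      by (intro sum_mono mult_left_mono) (auto simp: prob_simplex_def)
    moreover have "?R c \<le> ?R ?a" using \<open>A \<le> B\<close> by (intro c) auto
    ultimately show ?thesis using upper[OF l(1), of a] l(2) by linarith
  qed
  have iff: "is_arg_min ?R (\<lambda>_. True) a \<longleftrightarrow> a = c" for a
  proof
    assume "is_arg_min ?R (\<lambda>_. True) a"
    then have "?R a \<le> ?R b" for b by (simp add: is_arg_min_def not_less)
    from this[of "(a + c) / 2"] this[of c] min_c[of a] mid[of a c] show "a = c"
      by argo
  qed (use min_c in \<open>auto simp: is_arg_min_def not_less\<close>)
  have "optimal_headline \<sigma> Y \<Lambda> = c"
    unfolding optimal_headline_def using iff by (intro the_equality) blast+
  with iff show ?thesis by simp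
qed

end

theory Submission
  imports Defs
begin

text \<open>The problem is a zero-sum game between the action \<open>a\<close> and a prior in the
  class. The loss is affine in the prior and, for a fixed prior, a strictly convex quadratic in
  \<open>a\<close> minimized at its precision-weighted mean \<open>prior_headline\<close>. If
  \<open>l\<close> maximizes the minimal loss \<open>prior_value\<close> over a compact convex
  class, then \<open>l\<close> and its headline form a saddle point
  (\<open>prior_value_max_saddle\<close>), so the headline is the minimax action and the value of
  \<open>l\<close>, plus 1, is the optimized risk (\<open>optimal_headline_prior_value_max\<close>).

  For fixed \<open>a\<close> the worst case over the ratio class is a linear program. The favored
  priors are vertices of the class (\<open>favored_prior_extreme_point\<close>), which gives the
  lower bound in the closed form. The upper bound in \<open>worst_case_risk_ratio_class\<close> does
  not enumerate the vertices but bounds every prior directly.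

  As the ratio grows, the classes shrink towards the point mass on \<open>d\<close>. At
  \<open>Y $ d\<close> that design costs nothing and the others have weight at most the reciprocal
  of the ratio, so the optimized risk tends to 1. This in turn forces the headline to
  \<open>Y $ d\<close>.

  With two designs a prior is a single number p. Its value is an explicit function of p that is
  largest at p_\<Delta> and nonincreasing to the right of it (\<open>two_design_value_le\<close>),
  so the best p in [p_r, 1] is the larger of p_\<Delta> and p_r.\<close>

section \<open>Headline and value of a single prior\<close>

lemma prior_loss_quadratic:
  "prior_loss \<sigma> Y l a =
     (\<Sum>k\<in>UNIV. l $ k * (Y $ k)\<^sup>2 / (\<sigma> $ k)\<^sup>2) - 2 * a * (\<Sum>k\<in>UNIV. l $ k * Y $ k / (\<sigma> $ k)\<^sup>2)
     + a\<^sup>2 * (\<Sum>k\<in>UNIV. l $ k / (\<sigma> $ k)\<^sup>2)"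
proof -
  have "l $ k * (std_disc \<sigma> Y k a)\<^sup>2 =
      l $ k * (Y $ k)\<^sup>2 / (\<sigma> $ k)\<^sup>2 - 2 * a * (l $ k * Y $ k / (\<sigma> $ k)\<^sup>2) + a\<^sup>2 * (l $ k / (\<sigma> $ k)\<^sup>2)" for k
    \<comment> \<open>For a zero standard deviation both sides vanish, because division by zero
      yields 0.\<close>
    by (cases "\<sigma> $ k = 0") (simp_all add: std_disc_def power_divide field_simps power2_eq_square)
  then show ?thesis
    by (simp add: prior_loss_def sum.distrib sum_subtractf sum_distrib_left)
qed

lemma prob_simplexD:
  assumes "l \<in> prob_simplex"
  shows "0 \<le> l $ k" "(\<Sum>k\<in>UNIV. l $ k) = 1" "l $ k \<le> 1"
proof -
  show nonneg: "0 \<le> l $ k" and sum: "(\<Sum>k\<in>UNIV. l $ k) = 1" for k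
    using assms by (auto simp: prob_simplex_def)
  show "l $ k \<le> 1"
    using member_le_sum[of k UNIV "($) l"] nonneg sum by simp
qed

text \<open>This is the denominator of \<open>prior_headline\<close>, so the headline is a genuine
  quotient and depends continuously on the prior.\<close>

lemma prior_precision_pos:
  assumes "l \<in> prob_simplex" "\<And>k. \<sigma> $ k > 0"
  shows "0 < (\<Sum>k\<in>UNIV. l $ k / (\<sigma> $ k)\<^sup>2)"
proof -
  have "\<exists>k. l $ k \<noteq> 0"
  proof (rule ccontr)
    assume "\<nexists>k. l $ k \<noteq> 0"
    then show False using prob_simplexD(2)[OF assms(1)] by simp
  qed
  then obtain k where "l $ k \<noteq> 0" by blast
  then have "0 < l $ k" using prob_simplexD(1)[OF assms(1), of k] by simp
  then show ?thesis
    using prob_simplexD(1)[OF assms(1)] less_imp_neq[OF assms(2)[of k]]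
    by (intro sum_pos2[of _ k]) auto
qed

text \<open>Completing the square: the loss at \<open>a\<close> exceeds the value by the total
  precision times the squared distance of \<open>a\<close> from the headline.\<close>

lemma prior_value_le_prior_loss:
  assumes "l \<in> prob_simplex" "\<And>k. \<sigma> $ k > 0"
  shows "prior_value \<sigma> Y l \<le> prior_loss \<sigma> Y l a"
proof -
  define W where "W = (\<Sum>k\<in>UNIV. l $ k / (\<sigma> $ k)\<^sup>2)"
  define B where "B = (\<Sum>k\<in>UNIV. l $ k * Y $ k / (\<sigma> $ k)\<^sup>2)"
  have W: "0 < W" unfolding W_def using assms by (rule prior_precision_pos)
  have h: "prior_headline \<sigma> Y l = B / W" by (simp add: prior_headline_def B_def W_def)
  have "prior_loss \<sigma> Y l a - prior_value \<sigma> Y l = W * (a - B / W)\<^sup>2"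
    unfolding prior_value_def h prior_loss_quadratic B_def[symmetric] W_def[symmetric]
    using W by (simp add: field_simps power2_eq_square)
  moreover have "0 \<le> W * (a - B / W)\<^sup>2" using W by simp
  ultimately show ?thesis by linarith
qed

lemma continuous_on_prior_headline:
  assumes "\<And>k. \<sigma> $ k > 0"
  shows "continuous_on prob_simplex (prior_headline \<sigma> Y)"
  unfolding prior_headline_def using prior_precision_pos[OF _ assms]
  by (intro continuous_intros) (force simp: less_imp_neq[OF assms, symmetric])+

lemma continuous_on_prior_value:
  assumes "\<And>k. \<sigma> $ k > 0"
  shows "continuous_on prob_simplex (prior_value \<sigma> Y)"
  unfolding prior_value_def prior_loss_quadratic
  using continuous_on_prior_headline[OF assms]
  by (intro continuous_intros) (auto simp: less_imp_neq[OF assms, symmetric])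

lemma prior_value_attains_max:
  assumes "compact \<Lambda>" "\<Lambda> \<noteq> {}" "\<Lambda> \<subseteq> prob_simplex" "\<And>k. \<sigma> $ k > 0"
  shows "\<exists>l. is_arg_max (prior_value \<sigma> Y) (\<lambda>l. l \<in> \<Lambda>) l"
  using continuous_attains_sup[OF assms(1,2)
      continuous_on_subset[OF continuous_on_prior_value[OF assms(4), where Y = Y] assms(3)]]
  by (auto simp: is_arg_max_linorder)

section \<open>Minimax duality\<close>

lemma prior_loss_le_worst_case:
  assumes "compact \<Lambda>" "l \<in> \<Lambda>"
  shows "prior_loss \<sigma> Y l a + 1 \<le> worst_case_risk \<sigma> Y \<Lambda> a"
  by (rule worst_case_risk_attained[of \<Lambda> \<sigma> Y a]) (use assms in auto)

lemma prior_loss_affine: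
  "prior_loss \<sigma> Y ((1 - t) *\<^sub>R l + t *\<^sub>R l') a = (1 - t) * prior_loss \<sigma> Y l a + t * prior_loss \<sigma> Y l' a"
  by (simp add: prior_loss_def sum.distrib sum_distrib_left distrib_right mult.assoc)

text \<open>
  Moving from \<open>l\<close> towards \<open>l'\<close> by a step \<open>t\<close> cannot increase the prior value. Since the loss is
  affine in the prior, this bounds the loss of \<open>l'\<close> at the perturbed headline by the value of \<open>l\<close>;
  then let \<open>t\<close> tend to 0.
\<close>

lemma prior_value_max_saddle:
  assumes "convex \<Lambda>" and sub: "\<Lambda> \<subseteq> prob_simplex" and pos: "\<And>k. \<sigma> $ k > 0"
    and max: "is_arg_max (prior_value \<sigma> Y) (\<lambda>l. l \<in> \<Lambda>) l" and l': "l' \<in> \<Lambda>"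
  shows "prior_loss \<sigma> Y l' (prior_headline \<sigma> Y l) \<le> prior_value \<sigma> Y l"
proof -
  have l: "l \<in> \<Lambda>" and le: "\<And>x. x \<in> \<Lambda> \<Longrightarrow> prior_value \<sigma> Y x \<le> prior_value \<sigma> Y l"
    using max by (auto simp: is_arg_max_linorder)
  define z where "z t = (1 - t) *\<^sub>R l + t *\<^sub>R l'" for t
  have z: "z t \<in> \<Lambda>" if "t \<in> {0..1}" for t
    using assms(1) l l' that by (auto simp: convex_alt z_def)
  have step: "prior_loss \<sigma> Y l' (prior_headline \<sigma> Y (z t)) \<le> prior_value \<sigma> Y l" if t: "0 < t" "t \<le> 1" for t
  proof -
    have "prior_value \<sigma> Y (z t) \<le> prior_value \<sigma> Y l"
      using z t le by auto
    \<comment> \<open>The headline of \<open>z t\<close> need not be optimal for \<open>l\<close>,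
      so \<open>l\<close> incurs at least its own value there. After expanding the value of
      \<open>z t\<close>, only the share of \<open>l'\<close> remains to be bounded.\<close>
    moreover have "(1 - t) * prior_value \<sigma> Y l \<le> (1 - t) * prior_loss \<sigma> Y l (prior_headline \<sigma> Y (z t))"
      using l sub t prior_value_le_prior_loss[OF _ pos] by (intro mult_left_mono) auto
    moreover have "prior_value \<sigma> Y (z t) = (1 - t) * prior_loss \<sigma> Y l (prior_headline \<sigma> Y (z t))
        + t * prior_loss \<sigma> Y l' (prior_headline \<sigma> Y (z t))"
      by (subst prior_value_def, subst (1) z_def, rule prior_loss_affine)
    ultimately have "t * prior_loss \<sigma> Y l' (prior_headline \<sigma> Y (z t)) \<le> t * prior_value \<sigma> Y l"
      by (simp add: algebra_simps)
    with t show ?thesis by simp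
  qed
  have "continuous_on {0..1} (\<lambda>t. prior_headline \<sigma> Y (z t))"
    using z sub by (intro continuous_on_compose2[OF continuous_on_prior_headline[OF pos]])
      (auto simp: z_def intro!: continuous_intros)
  then have "continuous_on {0..1} (\<lambda>t. prior_loss \<sigma> Y l' (prior_headline \<sigma> Y (z t)))"
    unfolding prior_loss_quadratic by (intro continuous_intros)
  then have "((\<lambda>t. prior_loss \<sigma> Y l' (prior_headline \<sigma> Y (z t))) \<longlongrightarrow>
      prior_loss \<sigma> Y l' (prior_headline \<sigma> Y (z 0))) (at_right 0)"
    using continuous_on_Icc_at_rightD by force
  moreover have "\<forall>\<^sub>F t in at_right 0. prior_loss \<sigma> Y l' (prior_headline \<sigma> Y (z t)) \<le> prior_value \<sigma> Y l"
    using step by (auto simp: eventually_at_right[of 0 1] intro!: exI[of _ 1])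
  ultimately have "prior_loss \<sigma> Y l' (prior_headline \<sigma> Y (z 0)) \<le> prior_value \<sigma> Y l"
    by (rule tendsto_upperbound) simp
  then show ?thesis by (simp add: z_def)
qed

text \<open>A saddle point solves the game: since \<open>l\<close> is in the class, every action has
  risk at least its value plus 1, and by \<open>prior_value_max_saddle\<close> the headline of
  \<open>l\<close> stays within this bound. Uniqueness of the minimizer identifies the
  headline.\<close>

lemma optimal_headline_prior_value_max:
  assumes "convex \<Lambda>" and cpt: "compact \<Lambda>" and sub: "\<Lambda> \<subseteq> prob_simplex" and pos: "\<And>k. \<sigma> $ k > 0"
    and max: "is_arg_max (prior_value \<sigma> Y) (\<lambda>l. l \<in> \<Lambda>) l"
  shows "optimal_headline \<sigma> Y \<Lambda> = prior_headline \<sigma> Y l"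
    and "optimized_risk \<sigma> Y \<Lambda> = prior_value \<sigma> Y l + 1"
proof -
  have l: "l \<in> \<Lambda>" using max by (auto simp: is_arg_max_def)
  then have ne: "\<Lambda> \<noteq> {}" by auto
  let ?h = "prior_headline \<sigma> Y l"
  obtain l' where "l' \<in> \<Lambda>" "worst_case_risk \<sigma> Y \<Lambda> ?h = prior_loss \<sigma> Y l' ?h + 1"
    using worst_case_risk_attained[OF cpt ne] by metis
  with prior_value_max_saddle[OF assms(1) sub pos max]
  have upper: "worst_case_risk \<sigma> Y \<Lambda> ?h \<le> prior_value \<sigma> Y l + 1" by simp
  have lower: "prior_value \<sigma> Y l + 1 \<le> worst_case_risk \<sigma> Y \<Lambda> a" for a
    using prior_value_le_prior_loss[of l \<sigma> Y a] pos l sub prior_loss_le_worst_case[OF cpt l, of \<sigma> Y a]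
    by force
  have "is_arg_min (worst_case_risk \<sigma> Y \<Lambda>) (\<lambda>_. True) ?h"
    unfolding is_arg_min_linorder using upper lower order_trans by blast
  then show h: "optimal_headline \<sigma> Y \<Lambda> = ?h"
    using optimal_headline_unique[OF cpt ne sub pos] by simp
  show "optimized_risk \<sigma> Y \<Lambda> = prior_value \<sigma> Y l + 1"
    unfolding optimized_risk_def h using upper lower by (intro antisym)
qed

lemma optimized_risk_le:
  assumes "compact \<Lambda>" "\<Lambda> \<noteq> {}" "\<Lambda> \<subseteq> prob_simplex" "\<And>k. \<sigma> $ k > 0"
  shows "optimized_risk \<sigma> Y \<Lambda> \<le> worst_case_risk \<sigma> Y \<Lambda> a"
  using optimal_headline_unique[OF assms, of Y "optimal_headline \<sigma> Y \<Lambda>"]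
  by (simp add: optimized_risk_def is_arg_min_linorder)

lemma worst_case_risk_mono:
  assumes "compact \<Lambda>" "compact \<Lambda>'" "\<Lambda> \<subseteq> \<Lambda>'" "\<Lambda> \<noteq> {}"
  shows "worst_case_risk \<sigma> Y \<Lambda> a \<le> worst_case_risk \<sigma> Y \<Lambda>' a"
  using worst_case_risk_attained[OF assms(1,4), of \<sigma> Y a] prior_loss_le_worst_case[OF assms(2), of _ \<sigma> Y a]
    assms(3) by (metis subsetD)

lemma optimized_risk_mono:
  assumes "compact \<Lambda>" "compact \<Lambda>'" "\<Lambda> \<subseteq> \<Lambda>'" "\<Lambda> \<noteq> {}" "\<Lambda>' \<subseteq> prob_simplex" "\<And>k. \<sigma> $ k > 0"
  shows "optimized_risk \<sigma> Y \<Lambda> \<le> optimized_risk \<sigma> Y \<Lambda>'"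
proof -
  have "optimized_risk \<sigma> Y \<Lambda> \<le> worst_case_risk \<sigma> Y \<Lambda> (optimal_headline \<sigma> Y \<Lambda>')"
    using assms by (intro optimized_risk_le) auto
  also have "\<dots> \<le> optimized_risk \<sigma> Y \<Lambda>'"
    unfolding optimized_risk_def using assms by (intro worst_case_risk_mono)
  finally show ?thesis .
qed

section \<open>Monotonicity and limits in the ratio\<close>

lemma ratio_class_nonempty: "ratio_class d r \<noteq> {}"
  using axis_in_ratio_class by blast

lemma ratio_class_antimono: "s \<le> t \<Longrightarrow> ratio_class d t \<subseteq> ratio_class d s"
  unfolding ratio_class_def prob_simplex_def
  by clarsimp (meson mult_right_mono order_trans)

lemma prior_loss_axis: "prior_loss \<sigma> Y (axis d 1) a = (std_disc \<sigma> Y d a)\<^sup>2"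
  by (simp add: prior_loss_def axis_def if_distrib [of "\<lambda>x. x * _"] cong: if_cong)

text \<open>The point mass on \<open>d\<close> lies in every ratio class. This one bound yields both
  that the risk is at least 1 and that a risk near 1 puts the headline near
  \<open>Y $ d\<close>.\<close>

lemma favored_disc_le_optimized_risk:
  "(std_disc \<sigma> Y d (optimal_headline \<sigma> Y (ratio_class d r)))\<^sup>2 + 1 \<le> optimized_risk \<sigma> Y (ratio_class d r)"
  unfolding optimized_risk_def prior_loss_axis[symmetric]
  by (intro prior_loss_le_worst_case compact_ratio_class axis_in_ratio_class)

text \<open>Test the action \<open>Y $ d\<close>: the favored design then has no discrepancy, and
  every alternative has weight at most \<open>1 / s\<close>.\<close>

lemma optimized_risk_ratio_class_le:
  assumes "s > 0" and pos: "\<And>k. \<sigma> $ k > 0"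
  shows "optimized_risk \<sigma> Y (ratio_class d s) \<le> (\<Sum>k\<in>UNIV. (std_disc \<sigma> Y k (Y $ d))\<^sup>2) / s + 1"
proof -
  obtain l where l: "l \<in> ratio_class d s"
    "worst_case_risk \<sigma> Y (ratio_class d s) (Y $ d) = prior_loss \<sigma> Y l (Y $ d) + 1"
    using worst_case_risk_attained[OF compact_ratio_class ratio_class_nonempty] by metis
  have ls: "l \<in> prob_simplex" using l(1) ratio_class_subset by blast
  have "l $ k * (std_disc \<sigma> Y k (Y $ d))\<^sup>2 \<le> 1 / s * (std_disc \<sigma> Y k (Y $ d))\<^sup>2" for k
  proof (cases "k = d")
    case False
    then have "s * l $ k \<le> 1"
      using l(1) prob_simplexD(3)[OF ls, of d] order_trans unfolding ratio_class_def by blast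
    then have "l $ k \<le> 1 / s" using \<open>s > 0\<close> by (simp add: field_simps)
    then show ?thesis by (intro mult_right_mono) auto
  qed (simp add: std_disc_def)
  then have "prior_loss \<sigma> Y l (Y $ d) \<le> (\<Sum>k\<in>UNIV. 1 / s * (std_disc \<sigma> Y k (Y $ d))\<^sup>2)"
    unfolding prior_loss_def by (intro sum_mono)
  also have "\<dots> = (\<Sum>k\<in>UNIV. (std_disc \<sigma> Y k (Y $ d))\<^sup>2) / s"
    by (simp add: sum_divide_distrib)
  finally show ?thesis
    using optimized_risk_le[OF compact_ratio_class ratio_class_nonempty ratio_class_subset pos,
        of Y d s "Y $ d"] l(2)
    by linarith
qed

lemma optimized_risk_tendsto:
  assumes pos: "\<And>k. \<sigma> $ k > 0"
  shows "((\<lambda>s. optimized_risk \<sigma> Y (ratio_class d s)) \<longlongrightarrow> 1) at_top"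
proof (rule tendsto_sandwich)
  show "\<forall>\<^sub>F s in at_top. 1 \<le> optimized_risk \<sigma> Y (ratio_class d s)"
    by (intro always_eventually allI order_trans[OF _ favored_disc_le_optimized_risk]) simp
  show "\<forall>\<^sub>F s in at_top. optimized_risk \<sigma> Y (ratio_class d s)
      \<le> (\<Sum>k\<in>UNIV. (std_disc \<sigma> Y k (Y $ d))\<^sup>2) / s + 1"
    using eventually_gt_at_top[of 0] by eventually_elim (intro optimized_risk_ratio_class_le pos)
  have "((\<lambda>s. (\<Sum>k\<in>UNIV. (std_disc \<sigma> Y k (Y $ d))\<^sup>2) / s + 1) \<longlongrightarrow> 0 + 1) at_top"
    by (intro tendsto_add tendsto_const tendsto_divide_0[OF tendsto_const]
        filterlim_at_top_imp_at_infinity filterlim_ident)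
  then show "((\<lambda>s. (\<Sum>k\<in>UNIV. (std_disc \<sigma> Y k (Y $ d))\<^sup>2) / s + 1) \<longlongrightarrow> 1) at_top" by simp
qed auto

lemma optimal_headline_tendsto:
  assumes pos: "\<And>k. \<sigma> $ k > 0"
  shows "((\<lambda>s. optimal_headline \<sigma> Y (ratio_class d s)) \<longlongrightarrow> Y $ d) at_top"
proof -
  let ?h = "\<lambda>s. optimal_headline \<sigma> Y (ratio_class d s)"
  let ?b = "\<lambda>s. sqrt ((\<sigma> $ d)\<^sup>2 * (optimized_risk \<sigma> Y (ratio_class d s) - 1))"
  have le: "norm (?h s - Y $ d) \<le> ?b s" for s
  proof -
    have "(?h s - Y $ d)\<^sup>2 = (\<sigma> $ d)\<^sup>2 * (std_disc \<sigma> Y d (?h s))\<^sup>2"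
      using pos[of d] by (simp add: std_disc_def power_divide power2_commute)
    also have "\<dots> \<le> (\<sigma> $ d)\<^sup>2 * (optimized_risk \<sigma> Y (ratio_class d s) - 1)"
      using favored_disc_le_optimized_risk[of \<sigma> Y d s] by (intro mult_left_mono) auto
    finally show ?thesis
      by (intro real_le_rsqrt) (simp only: real_norm_def power2_abs)
  qed
  have "(?b \<longlongrightarrow> sqrt ((\<sigma> $ d)\<^sup>2 * (1 - 1))) at_top"
    by (intro tendsto_intros optimized_risk_tendsto pos)
  moreover have "sqrt ((\<sigma> $ d)\<^sup>2 * (1 - 1)) = 0" by simp
  ultimately have "(?b \<longlongrightarrow> 0) at_top" by (simp only:)
  then have "((\<lambda>s. ?h s - Y $ d) \<longlongrightarrow> 0) at_top"
    by (rule Lim_null_comparison[OF always_eventually, rotated]) (intro allI le)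
  then show ?thesis by (rule LIM_zero_cancel)
qed

section \<open>Order statistics of the discrepancies\<close>

text \<open>The concatenation is sorted and has the right multiset, which determines it. The
  dominant block comes last because the order is ascending; \<open>rev\<close> moves it to the
  front.\<close>

lemma sorted_list_of_multiset_split:
  fixes f :: "'a \<Rightarrow> 'b::linorder"
  assumes "finite A" "S \<subseteq> A" and top: "\<And>k l. k \<in> S \<Longrightarrow> l \<in> A - S \<Longrightarrow> f l \<le> f k"
  shows "sorted_list_of_multiset (image_mset f (mset_set A)) =
     sorted_list_of_multiset (image_mset f (mset_set (A - S))) @
     sorted_list_of_multiset (image_mset f (mset_set S))" (is "?l A = ?l (A - S) @ ?l S")
proof -
  have fin: "finite S" "finite (A - S)" using assms finite_subset by auto
  have "mset_set A = mset_set (A - S) + mset_set S"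
    using assms(2) fin by (subst mset_set_Union[symmetric]) (auto simp: Un_absorb2)
  then have "mset (?l (A - S) @ ?l S) = image_mset f (mset_set A)"
    by simp
  moreover have "sorted (?l (A - S) @ ?l S)"
    using top fin by (auto simp: sorted_append)
  ultimately show ?thesis
    by (metis sorted_list_of_multiset_mset sorted_sort_id)
qed

text \<open>The first \<open>m\<close> entries of the descending list are the values on
  \<open>S\<close> in some order. Hence ties do not matter: all sets of top alternatives give the
  same sum.\<close>

lemma sum_sq_disc_desc:
  assumes "top_alternatives \<sigma> Y d a m S"
  shows "(\<Sum>j=1..m. sq_disc_desc \<sigma> Y d a j) = (\<Sum>k\<in>S. (std_disc \<sigma> Y k a)\<^sup>2)"
proof -
  let ?f = "\<lambda>k. (std_disc \<sigma> Y k a)\<^sup>2"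
  define L where "L A = rev (sorted_list_of_multiset (image_mset ?f (mset_set A)))" for A
  have S: "S \<subseteq> UNIV - {d}" "card S = m" using assms by (auto simp: top_alternatives_def)
  have fin: "finite S" by simp
  have split: "L (UNIV - {d}) = L S @ L (UNIV - {d} - S)"
    unfolding L_def using assms
    by (subst sorted_list_of_multiset_split[of "UNIV - {d}" S]) (auto simp: top_alternatives_def)
  have "length (L S) = size (mset (L S))" by simp
  also have "\<dots> = m" unfolding L_def using S by simp
  finally have len: "length (L S) = m" .
  \<comment> \<open>Order statistics count from 1, list positions from 0.\<close>
  have "(\<Sum>j=1..m. sq_disc_desc \<sigma> Y d a j) = (\<Sum>i<m. L (UNIV - {d}) ! i)"
    by (rule sum.reindex_bij_witness[of _ Suc "\<lambda>j. j - 1"]) (auto simp: sq_disc_desc_def L_def)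
  also have "\<dots> = (\<Sum>i<m. L S ! i)"
    unfolding split using len by (intro sum.cong) (auto simp: nth_append)
  also have "\<dots> = sum_list (L S)"
    using len by (simp add: sum_list_sum_nth atLeast0LessThan)
  also have "\<dots> = sum_mset (mset (L S))" by (simp add: sum_mset_sum_list)
  also have "\<dots> = (\<Sum>k\<in>S. ?f k)" by (simp add: L_def sum_unfold_sum_mset)
  finally show ?thesis .
qed

text \<open>Greedy choice: a top set is enlarged by a largest remaining alternative.\<close>

lemma top_alternatives_exist:
  fixes d :: "'n::finite"
  assumes "m \<le> CARD('n) - 1"
  shows "\<exists>S. top_alternatives \<sigma> Y d a m S"
  using assms
proof (induction m)
  case 0
  show ?case by (auto simp: top_alternatives_def intro!: exI[of _ "{}"])
next
  case (Suc m)
  let ?f = "\<lambda>k. (std_disc \<sigma> Y k a)\<^sup>2"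
  obtain S where S: "S \<subseteq> UNIV - {d}" "card S = m" "\<And>k l. k \<in> S \<Longrightarrow> l \<in> UNIV - {d} - S \<Longrightarrow> ?f l \<le> ?f k"
    using Suc by (auto simp: top_alternatives_def)
  have "card (UNIV - {d} - S) = CARD('n) - 1 - m"
    using S by (simp add: card_Diff_subset card_Diff_singleton)
  with Suc.prems have "UNIV - {d} - S \<noteq> {}" by (metis Suc_le_lessD card.empty zero_less_diff less_irrefl)
  then have "Max (?f ` (UNIV - {d} - S)) \<in> ?f ` (UNIV - {d} - S)" by (intro Max_in) auto
  then obtain k where k: "k \<in> UNIV - {d} - S" "?f k = Max (?f ` (UNIV - {d} - S))" by fastforce
  have max: "?f l \<le> ?f k" if "l \<in> UNIV - {d} - S" for l
    unfolding k(2) using that by (intro Max_ge) auto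
  have "top_alternatives \<sigma> Y d a (Suc m) (insert k S)"
    unfolding top_alternatives_def using S k(1) max by auto
  then show ?case by blast
qed

section \<open>Extreme priors and the closed form of the risk\<close>

lemma sum_favored:
  fixes d :: "'n::finite"
  assumes "\<And>k. k \<noteq> d \<Longrightarrow> k \<notin> S \<Longrightarrow> g k = (0::real)" "d \<notin> S"
  shows "(\<Sum>k\<in>UNIV. g k) = g d + (\<Sum>k\<in>S. g k)"
proof -
  have "(\<Sum>k\<in>UNIV. g k) = (\<Sum>k\<in>insert d S. g k)"
    using assms by (intro sum.mono_neutral_right) auto
  with assms(2) show ?thesis by simp
qed

text \<open>Kept general in \<open>g\<close>: the constant 1 gives the normalization, the squared
  discrepancies give the terms of the maximum.\<close>

lemma favored_prior_loss:
  assumes "d \<notin> S"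
  shows "(\<Sum>k\<in>UNIV. favored_prior d r m S $ k * g k) = (r * g d + (\<Sum>k\<in>S. g k)) / (r + real m)"
proof -
  have "(\<Sum>k\<in>S. favored_prior d r m S $ k * g k) = (\<Sum>k\<in>S. g k / (r + real m))"
    using assms by (intro sum.cong) (auto simp: favored_prior_def)
  moreover have "(\<Sum>k\<in>UNIV. favored_prior d r m S $ k * g k)
      = favored_prior d r m S $ d * g d + (\<Sum>k\<in>S. favored_prior d r m S $ k * g k)"
    using assms by (intro sum_favored) (auto simp: favored_prior_def)
  ultimately show ?thesis
    by (simp add: favored_prior_def add_divide_distrib sum_divide_distrib)
qed

lemma favored_prior_in_ratio_class:
  assumes "d \<notin> S" "card S = m" "r \<ge> 1"
  shows "favored_prior d r m S \<in> ratio_class d r"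
proof -
  have "(\<Sum>k\<in>UNIV. favored_prior d r m S $ k) = 1"
    using favored_prior_loss[OF assms(1), of r m "\<lambda>_. 1"] assms(2,3) by simp
  then show ?thesis
    using assms(3) by (auto simp: ratio_class_def prob_simplex_def favored_prior_def)
qed

text \<open>The constraints active at the favored prior, together with normalization, form a linear
  system with one solution.\<close>

lemma favored_prior_unique:
  assumes S: "d \<notin> S" "card S = m" "r \<ge> 1" and z: "z \<in> prob_simplex"
    "\<And>k. k \<noteq> d \<Longrightarrow> k \<notin> S \<Longrightarrow> z $ k = 0" "\<And>k. k \<in> S \<Longrightarrow> z $ d = r * z $ k"
  shows "z = favored_prior d r m S"
proof -
  have zk: "z $ k = z $ d / r" if "k \<in> S" for k
    using z(3)[OF that] S(3) by (simp add: field_simps)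
  have "1 = z $ d + (\<Sum>k\<in>S. z $ k)"
    using sum_favored[of d S "($) z"] z S prob_simplexD(2)[OF z(1)] by simp
  also have "(\<Sum>k\<in>S. z $ k) = real m * (z $ d / r)"
    using S(2) zk by (simp cong: sum.cong)
  finally have zd: "z $ d = r / (r + real m)"
    using S(3) by (simp add: field_simps)
  then show ?thesis
    using z(2) zk S(1,3) by (auto simp: vec_eq_iff favored_prior_def)
qed

text \<open>A constraint that is tight at an interior point of a segment in the class is tight at
  both ends, since slacks are nonnegative. Both ends therefore satisfy the system of
  \<open>favored_prior_unique\<close> and coincide.\<close>

lemma favored_prior_extreme_point:
  assumes S: "d \<notin> S" "card S = m" "r \<ge> 1"
  shows "favored_prior d r m S extreme_point_of ratio_class d r"
  unfolding extreme_point_of_def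
proof (intro conjI ballI favored_prior_in_ratio_class S notI)
  let ?v = "favored_prior d r m S"
  fix x y assume x: "x \<in> ratio_class d r" and y: "y \<in> ratio_class d r" and "?v \<in> open_segment x y"
  then obtain t where t: "0 < t" "t < 1" and v: "?v = (1 - t) *\<^sub>R x + t *\<^sub>R y" and "x \<noteq> y"
    by (auto simp: in_segment)
  have tight: "p = 0 \<and> q = 0" if "(1 - t) * p + t * q = 0" "0 \<le> p" "0 \<le> q" for p q
    using that t by (simp add: add_nonneg_eq_0_iff)
  have vk: "?v $ k = (1 - t) * x $ k + t * y $ k" for k unfolding v by simp
  have xs: "x \<in> prob_simplex" and ys: "y \<in> prob_simplex" using x y ratio_class_subset by blast+
  have zero: "x $ k = 0 \<and> y $ k = 0" if "k \<noteq> d" "k \<notin> S" for k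
    using tight[of "x $ k" "y $ k"] vk[of k] that prob_simplexD(1)[OF xs, of k] prob_simplexD(1)[OF ys, of k]
    by (simp add: favored_prior_def)
  have ratio: "x $ d = r * x $ k \<and> y $ d = r * y $ k" if "k \<in> S" for k
  proof -
    have "k \<noteq> d" using that S by auto
    then have "?v $ d = r * ?v $ k" using that by (simp add: favored_prior_def)
    then have "(1 - t) * (x $ d - r * x $ k) + t * (y $ d - r * y $ k) = 0"
      unfolding vk by (simp add: algebra_simps)
    then show ?thesis
      using tight[of "x $ d - r * x $ k" "y $ d - r * y $ k"] x y \<open>k \<noteq> d\<close> by (auto simp: ratio_class_def)
  qed
  have "x = ?v" "y = ?v"
    using zero ratio xs ys S by (auto intro!: favored_prior_unique)
  with \<open>x \<noteq> y\<close> show False by simp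
qed

text \<open>
  For the upper bound let \<open>M\<close> be the maximum on the right and \<open>S\<close> the set of alternatives with
  squared discrepancy above \<open>M\<close>: it is a set of top alternatives, so its term is at most \<open>M\<close>, and
  a prior in the class has expected excess over \<open>M\<close> at most \<open>l $ d / r\<close> times the excess of that term.
\<close>

lemma worst_case_risk_ratio_class:
  fixes d :: "'n::finite"
  assumes r: "r \<ge> 1"
  shows "worst_case_risk \<sigma> Y (ratio_class d r) a =
         Max ((\<lambda>m. (r * (std_disc \<sigma> Y d a)\<^sup>2 + (\<Sum>j=1..m. sq_disc_desc \<sigma> Y d a j)) / (r + real m))
              ` {0..CARD('n) - 1}) + 1"
proof -
  let ?f = "\<lambda>k. (std_disc \<sigma> Y k a)\<^sup>2"
  define T where "T m = (r * ?f d + (\<Sum>j=1..m. sq_disc_desc \<sigma> Y d a j)) / (r + real m)" for m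
  define M where "M = Max (T ` {0..CARD('n) - 1})"
  have TS: "T m = (r * ?f d + (\<Sum>k\<in>S. ?f k)) / (r + real m)" if "top_alternatives \<sigma> Y d a m S" for m S
    unfolding T_def sum_sq_disc_desc[OF that] ..
  have TM: "T m \<le> M" if "m \<le> CARD('n) - 1" for m
    unfolding M_def using that by (intro Max_ge) auto
  have upper: "prior_loss \<sigma> Y l a \<le> M" if l: "l \<in> ratio_class d r" for l
  proof -
    have ls: "l \<in> prob_simplex" using l ratio_class_subset by blast
    define S where "S = {k \<in> UNIV - {d}. M < ?f k}"
    have "d \<notin> S" by (simp add: S_def)
    have top: "top_alternatives \<sigma> Y d a (card S) S"
      by (auto simp: top_alternatives_def S_def)
    have "card S \<le> card (UNIV - {d})" by (rule card_mono) (auto simp: S_def)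
    then have "T (card S) \<le> M" by (intro TM) (simp add: card_Diff_singleton)
    then have "r * ?f d + (\<Sum>k\<in>S. ?f k) \<le> M * (r + real (card S))"
      unfolding TS[OF top] using r by (simp add: field_simps)
    \<comment> \<open>Divide by \<open>r\<close> and distribute \<open>M\<close> over
      \<open>d\<close> and the members of \<open>S\<close>: this is the inequality
      \<open>T (card S) \<le> M\<close> in terms of excesses.\<close>
    then have excess: "(?f d - M) + (\<Sum>k\<in>S. ?f k - M) / r \<le> 0"
      using r by (simp add: sum_subtractf field_simps)
    \<comment> \<open>Alternatives outside \<open>S\<close> have nonpositive excess and are dropped;
      those in \<open>S\<close> have positive excess, so their weight may be raised to its cap
      \<open>l $ d / r\<close>.\<close>
    have le: "l $ k * (?f k - M) \<le> (if k = d then l $ d * (?f d - M) else if k \<in> S then l $ d / r * (?f k - M) else 0)" for k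
    proof (cases "k = d \<or> k \<notin> S")
      case True
      then show ?thesis
        using prob_simplexD(1)[OF ls, of k] by (auto simp: S_def mult_nonneg_nonpos)
    next
      case False
      then have "l $ k \<le> l $ d / r"
        using l r by (auto simp: ratio_class_def field_simps)
      moreover have "0 \<le> ?f k - M" using False by (simp add: S_def)
      ultimately have "l $ k * (?f k - M) \<le> l $ d / r * (?f k - M)" by (rule mult_right_mono)
      with False show ?thesis by simp
    qed
    have "prior_loss \<sigma> Y l a - M = (\<Sum>k\<in>UNIV. l $ k * (?f k - M))"
      using prob_simplexD(2)[OF ls]
      by (simp add: prior_loss_def right_diff_distrib sum_subtractf flip: sum_distrib_right)
    also have "\<dots> \<le> (\<Sum>k\<in>UNIV. (if k = d then l $ d * (?f d - M) else if k \<in> S then l $ d / r * (?f k - M) else 0))"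
      by (intro sum_mono le)
    also have "\<dots> = l $ d * (?f d - M) + (\<Sum>k\<in>S. l $ d / r * (?f k - M))"
      using \<open>d \<notin> S\<close> by (subst sum_favored[of d S]) (auto intro!: sum.cong)
    also have "\<dots> = l $ d * ((?f d - M) + (\<Sum>k\<in>S. ?f k - M) / r)"
      by (simp add: distrib_left sum_distrib_left sum_divide_distrib)
    also have "\<dots> \<le> 0"
      using excess prob_simplexD(1)[OF ls, of d] by (rule mult_nonneg_nonpos[rotated])
    finally show ?thesis by simp
  qed
  \<comment> \<open>Each term is the loss of a favored prior, which belongs to the class.\<close>
  have lower: "T m + 1 \<le> worst_case_risk \<sigma> Y (ratio_class d r) a" if m: "m \<le> CARD('n) - 1" for m
  proof -
    obtain S where S: "top_alternatives \<sigma> Y d a m S" using top_alternatives_exist[OF m] by blast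
    then have "d \<notin> S" "card S = m" by (auto simp: top_alternatives_def)
    then show ?thesis
      using prior_loss_le_worst_case[OF compact_ratio_class favored_prior_in_ratio_class[OF _ _ r], of d S m \<sigma> Y a]
      unfolding prior_loss_def favored_prior_loss[OF \<open>d \<notin> S\<close>] TS[OF S] by simp
  qed
  obtain l where "l \<in> ratio_class d r" "worst_case_risk \<sigma> Y (ratio_class d r) a = prior_loss \<sigma> Y l a + 1"
    using worst_case_risk_attained[OF compact_ratio_class ratio_class_nonempty] by metis
  moreover have "M + 1 \<le> worst_case_risk \<sigma> Y (ratio_class d r) a"
  proof -
    have "M \<in> T ` {0..CARD('n) - 1}" unfolding M_def by (intro Max_in) auto
    with lower show ?thesis by auto
  qed
  ultimately show ?thesis
    unfolding T_def[symmetric] M_def[symmetric] using upper by force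
qed

section \<open>Two designs\<close>

text \<open>The value of a prior with weight \<open>p\<close> on the favored design, divided by the
  squared difference of the two estimates; \<open>s\<close> and \<open>t\<close> are the standard
  deviations of the favored design and the alternative.\<close>

definition two_design_value :: "real \<Rightarrow> real \<Rightarrow> real \<Rightarrow> real" where
  "two_design_value s t p = p * (1 - p) / (p * t\<^sup>2 + (1 - p) * s\<^sup>2)"

lemma two_design_denom_pos:
  fixes s t :: real
  assumes "s > 0" "t > 0" "0 \<le> p" "p \<le> 1"
  shows "0 < p * t\<^sup>2 + (1 - p) * s\<^sup>2"
proof (cases "p = 0")
  case False
  then show ?thesis using assms by (intro add_pos_nonneg) auto
qed (use assms in auto)

text \<open>With denominators cleared, the value at \<open>p\<close> minus the value at
  \<open>q\<close> is the product in \<open>key\<close>. The two cases of \<open>opt\<close> express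
  that \<open>s / (s + t)\<close> is the global maximizer and that the value does not increase
  beyond it.\<close>

lemma two_design_value_le:
  fixes s t :: real
  assumes st: "s > 0" "t > 0" and p: "0 \<le> p" "p \<le> 1" and q: "0 \<le> q" "q \<le> 1"
    and opt: "p = s / (s + t) \<or> s / (s + t) \<le> p \<and> p \<le> q"
  shows "two_design_value s t q \<le> two_design_value s t p"
proof -
  have key: "0 \<le> (p - q) * ((1 - p) * (1 - q) * s\<^sup>2 - p * q * t\<^sup>2)"
    using opt
  proof
    assume pe: "p = s / (s + t)"
    \<comment> \<open>This balance characterizes the maximizer and turns the second factor into a
      positive multiple of \<open>p - q\<close>, provided \<open>p\<close> is positive, as it is
      here.\<close>
    have "p * t = (1 - p) * s" unfolding pe using st by (simp add: field_simps)
    then have "(1 - p) * (1 - q) * s\<^sup>2 - p * q * t\<^sup>2 = p * t * ((1 - q) * s - q * t)"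
      by (simp add: power2_eq_square) algebra
    also have "(1 - q) * s - q * t = (s + t) * (p - q)"
      unfolding pe using st by (simp add: field_simps)
    finally have "(p - q) * ((1 - p) * (1 - q) * s\<^sup>2 - p * q * t\<^sup>2) = p * t * (s + t) * (p - q)\<^sup>2"
      by (simp add: power2_eq_square)
    also have "\<dots> \<ge> 0" using st p by simp
    finally show ?thesis .
  next
    assume le: "s / (s + t) \<le> p \<and> p \<le> q"
    have *: "(1 - x) * s \<le> x * t" if "s / (s + t) \<le> x" for x
      using that st by (simp add: field_simps)
    \<comment> \<open>To the right of the maximizer the balance tips the same way at
      \<open>p\<close> and at \<open>q\<close>; multiplying the two inequalities fixes the sign of
      the second factor.\<close>
    have "((1 - p) * s) * ((1 - q) * s) \<le> (p * t) * (q * t)"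
    proof (rule mult_mono)
      show "(1 - p) * s \<le> p * t" using le by (intro *) simp
      show "(1 - q) * s \<le> q * t" using le by (intro *) linarith
    qed (use st p q in simp_all)
    then have "(1 - p) * (1 - q) * s\<^sup>2 - p * q * t\<^sup>2 \<le> 0"
      by (simp add: power2_eq_square mult_ac)
    then show ?thesis using le by (intro mult_nonpos_nonpos) auto
  qed
  have "q * (1 - q) * (p * t\<^sup>2 + (1 - p) * s\<^sup>2) \<le> p * (1 - p) * (q * t\<^sup>2 + (1 - q) * s\<^sup>2)"
    using key by (simp add: algebra_simps)
  then show ?thesis
    unfolding two_design_value_def
    using two_design_denom_pos[OF st p] two_design_denom_pos[OF st q]
    by (simp only: pos_divide_le_eq pos_le_divide_eq times_divide_eq_left)
qed

lemma UNIV_two_designs: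
  fixes d e :: "'n::finite"
  assumes "CARD('n) = 2" "e \<noteq> d"
  shows "UNIV = {d, e}"
  using assms by (intro card_seteq[symmetric]) auto

lemma two_design_prior_headline:
  fixes d e :: "'n::finite"
  assumes "CARD('n) = 2" "e \<noteq> d" "l \<in> prob_simplex"
  shows "prior_headline \<sigma> Y l =
    (l $ d * Y $ d / (\<sigma> $ d)\<^sup>2 + (1 - l $ d) * Y $ e / (\<sigma> $ e)\<^sup>2) /
    (l $ d / (\<sigma> $ d)\<^sup>2 + (1 - l $ d) / (\<sigma> $ e)\<^sup>2)"
proof -
  have "l $ e = 1 - l $ d"
    using prob_simplexD(2)[OF assms(3)] assms(2) unfolding UNIV_two_designs[OF assms(1,2)] by simp
  then show ?thesis
    using assms(2) unfolding prior_headline_def UNIV_two_designs[OF assms(1,2)] by simp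
qed

lemma two_design_prior_value:
  fixes d e :: "'n::finite"
  assumes "CARD('n) = 2" "e \<noteq> d" and l: "l \<in> prob_simplex" and pos: "\<And>k. \<sigma> $ k > 0"
  shows "prior_value \<sigma> Y l = two_design_value (\<sigma> $ d) (\<sigma> $ e) (l $ d) * (Y $ d - Y $ e)\<^sup>2"
proof -
  define p s t y z where defs: "p = l $ d" "s = \<sigma> $ d" "t = \<sigma> $ e" "y = Y $ d" "z = Y $ e"
  have st: "s > 0" "t > 0" using pos by (auto simp: defs)
  define D where "D = p * t\<^sup>2 + (1 - p) * s\<^sup>2"
  have D: "0 < D"
    unfolding D_def using st prob_simplexD(1,3)[OF l, of d] by (intro two_design_denom_pos) (auto simp: defs)
  have le: "l $ e = 1 - p"
    using prob_simplexD(2)[OF l] assms(2) unfolding UNIV_two_designs[OF assms(1,2)] by (simp add: defs)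
  have "p * y / s\<^sup>2 + (1 - p) * z / t\<^sup>2 = (p * t\<^sup>2 * y + (1 - p) * s\<^sup>2 * z) / (s\<^sup>2 * t\<^sup>2)"
    "p / s\<^sup>2 + (1 - p) / t\<^sup>2 = D / (s\<^sup>2 * t\<^sup>2)"
    unfolding D_def using st by (simp_all add: field_simps)
  then have h: "prior_headline \<sigma> Y l = (p * t\<^sup>2 * y + (1 - p) * s\<^sup>2 * z) / D"
    unfolding two_design_prior_headline[OF assms(1,2) l] defs[symmetric] using st by simp
  have y: "y - prior_headline \<sigma> Y l = (1 - p) * s\<^sup>2 * (y - z) / D"
    and z: "z - prior_headline \<sigma> Y l = - (p * t\<^sup>2 * (y - z) / D)"
    unfolding h using D by (simp_all add: field_simps) (simp_all add: D_def algebra_simps)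
  have "prior_value \<sigma> Y l = p * ((1 - p) * s\<^sup>2 * (y - z) / D)\<^sup>2 / s\<^sup>2 + (1 - p) * (p * t\<^sup>2 * (y - z) / D)\<^sup>2 / t\<^sup>2"
    using assms(2) y z le
    unfolding prior_value_def prior_loss_def std_disc_def UNIV_two_designs[OF assms(1,2)]
    by (simp add: power_divide defs)
  also have "p * ((1 - p) * s\<^sup>2 * (y - z) / D)\<^sup>2 / s\<^sup>2 = p * (1 - p) * (y - z)\<^sup>2 * ((1 - p) * s\<^sup>2) / D\<^sup>2"
    using st by (simp add: power2_eq_square)
  also have "(1 - p) * (p * t\<^sup>2 * (y - z) / D)\<^sup>2 / t\<^sup>2 = p * (1 - p) * (y - z)\<^sup>2 * (p * t\<^sup>2) / D\<^sup>2"
    using st by (simp add: power2_eq_square)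
  \<comment> \<open>Besides the common factor, the two contributions add up to \<open>D\<close>,
    which cancels one power of the denominator.\<close>
  also have "p * (1 - p) * (y - z)\<^sup>2 * ((1 - p) * s\<^sup>2) / D\<^sup>2 + p * (1 - p) * (y - z)\<^sup>2 * (p * t\<^sup>2) / D\<^sup>2
      = p * (1 - p) * (y - z)\<^sup>2 * D / D\<^sup>2"
    unfolding D_def add_divide_distrib[symmetric] by (simp only: distrib_left add.commute)
  also have "\<dots> = p * (1 - p) / D * (y - z)\<^sup>2"
    using D by (simp add: power2_eq_square)
  finally show ?thesis by (simp add: two_design_value_def D_def defs)
qed

lemma two_design_prior_in_simplex:
  fixes d e :: "'n::finite"
  assumes "CARD('n) = 2" "e \<noteq> d" "0 \<le> p" "p \<le> 1"
  shows "(\<chi> k. if k = d then p else 1 - p) \<in> prob_simplex"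
  using assms unfolding prob_simplex_def UNIV_two_designs[OF assms(1,2)] by simp

lemma two_design_ratio_class_iff:
  fixes d e :: "'n::finite"
  assumes "CARD('n) = 2" "e \<noteq> d" "r \<ge> 1"
  shows "l \<in> ratio_class d r \<longleftrightarrow> l \<in> prob_simplex \<and> r / (r + 1) \<le> l $ d"
proof -
  have all: "(\<forall>k. k \<noteq> d \<longrightarrow> r * l $ k \<le> l $ d) \<longleftrightarrow> r * l $ e \<le> l $ d"
    using UNIV_two_designs[OF assms(1,2)] assms(2) by auto
  have "l \<in> ratio_class d r \<longleftrightarrow> l \<in> prob_simplex \<and> r * l $ e \<le> l $ d"
    by (simp add: ratio_class_def all)
  moreover have "l $ e = 1 - l $ d" if "l \<in> prob_simplex"
    using prob_simplexD(2)[OF that] assms(2) unfolding UNIV_two_designs[OF assms(1,2)] by simp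
  moreover have "r * (1 - l $ d) \<le> l $ d \<longleftrightarrow> r / (r + 1) \<le> l $ d"
    using assms(3) by (simp add: field_simps)
  ultimately show ?thesis by auto
qed

text \<open>Stated for a general class so that it serves both the ratio class and the whole simplex.
  Either \<open>p\<close> is the unrestricted maximizer, or it lies to its right and is the smallest
  favored weight in the class.\<close>

lemma two_design_optimum:
  fixes d e :: "'n::finite"
  assumes n: "CARD('n) = 2" "e \<noteq> d" and pos: "\<And>k. \<sigma> $ k > 0"
    and \<Lambda>: "convex \<Lambda>" "compact \<Lambda>" "\<Lambda> \<subseteq> prob_simplex"
    and p: "0 \<le> p" "p \<le> 1" "(\<chi> k. if k = d then p else 1 - p) \<in> \<Lambda>"
    and opt: "p = \<sigma> $ d / (\<sigma> $ d + \<sigma> $ e) \<or>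
      \<sigma> $ d / (\<sigma> $ d + \<sigma> $ e) \<le> p \<and> (\<forall>l\<in>\<Lambda>. p \<le> l $ d)"
  shows "optimal_headline \<sigma> Y \<Lambda> =
      (p * Y $ d / (\<sigma> $ d)\<^sup>2 + (1 - p) * Y $ e / (\<sigma> $ e)\<^sup>2) / (p / (\<sigma> $ d)\<^sup>2 + (1 - p) / (\<sigma> $ e)\<^sup>2)"
    and "optimized_risk \<sigma> Y \<Lambda> =
      p * (1 - p) * (Y $ d - Y $ e)\<^sup>2 / (p * (\<sigma> $ e)\<^sup>2 + (1 - p) * (\<sigma> $ d)\<^sup>2) + 1"
proof -
  let ?l = "\<chi> k. if k = d then p else 1 - p"
  have ls: "?l \<in> prob_simplex" using p(3) \<Lambda>(3) by blast
  have le: "prior_value \<sigma> Y x \<le> prior_value \<sigma> Y ?l" if x: "x \<in> \<Lambda>" for x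
  proof -
    have xs: "x \<in> prob_simplex" using x \<Lambda>(3) by blast
    have "two_design_value (\<sigma> $ d) (\<sigma> $ e) (x $ d) \<le> two_design_value (\<sigma> $ d) (\<sigma> $ e) p"
      using pos p opt x prob_simplexD(1,3)[OF xs, of d] by (intro two_design_value_le) auto
    then show ?thesis
      unfolding two_design_prior_value[OF n xs pos] two_design_prior_value[OF n ls pos]
      by (intro mult_right_mono) auto
  qed
  have max: "is_arg_max (prior_value \<sigma> Y) (\<lambda>l. l \<in> \<Lambda>) ?l"
    using p(3) le by (simp add: is_arg_max_linorder)
  note sol = optimal_headline_prior_value_max[OF \<Lambda> pos max]
  show "optimal_headline \<sigma> Y \<Lambda> =
      (p * Y $ d / (\<sigma> $ d)\<^sup>2 + (1 - p) * Y $ e / (\<sigma> $ e)\<^sup>2) / (p / (\<sigma> $ d)\<^sup>2 + (1 - p) / (\<sigma> $ e)\<^sup>2)"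
    unfolding sol(1) two_design_prior_headline[OF n ls] by simp
  show "optimized_risk \<sigma> Y \<Lambda> =
      p * (1 - p) * (Y $ d - Y $ e)\<^sup>2 / (p * (\<sigma> $ e)\<^sup>2 + (1 - p) * (\<sigma> $ d)\<^sup>2) + 1"
    unfolding sol(2) two_design_prior_value[OF n ls pos] by (simp add: two_design_value_def)
qed

text \<open>Since \<open>c\<close> does not exceed the right end, only the left end can bind in the
  projection onto the interval.\<close>

lemma is_arg_min_dist_Icc:
  fixes a b c :: real
  assumes "a \<le> b" "c \<le> b"
  shows "is_arg_min (\<lambda>q. \<bar>q - c\<bar>) (\<lambda>q. q \<in> {a..b}) q \<longleftrightarrow> q = max c a"
proof
  assume "is_arg_min (\<lambda>q. \<bar>q - c\<bar>) (\<lambda>q. q \<in> {a..b}) q"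
  moreover have "max c a \<in> {a..b}" using assms by auto
  ultimately have "q \<in> {a..b}" "\<bar>q - c\<bar> \<le> \<bar>max c a - c\<bar>"
    unfolding is_arg_min_linorder by blast+
  then show "q = max c a" by (auto simp: max_def split: if_splits)
qed (use assms in \<open>auto simp: is_arg_min_linorder max_def\<close>)

theorem proposition5:
  fixes Y \<sigma> :: "real^'n" and d :: 'n and r :: real
  assumes K: "CARD('n) \<ge> 2"
    and \<sigma>_pos: "\<forall>k. \<sigma> $ k > 0"
    and r: "r \<ge> 1"
  shows
   "(\<forall>a. is_arg_min (worst_case_risk \<sigma> Y (ratio_class d r)) (\<lambda>_. True) a \<longleftrightarrow>
         a = optimal_headline \<sigma> Y (ratio_class d r)) \<and>
    (\<forall>a. worst_case_risk \<sigma> Y (ratio_class d r) a =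
         Max ((\<lambda>m. (r * (std_disc \<sigma> Y d a)\<^sup>2 + (\<Sum>j=1..m. sq_disc_desc \<sigma> Y d a j)) / (r + real m))
              ` {0..CARD('n) - 1}) + 1) \<and>
    (\<forall>a. \<forall>m\<in>{0..CARD('n) - 1}.
         (\<exists>S. top_alternatives \<sigma> Y d a m S) \<and>
         (\<forall>S. top_alternatives \<sigma> Y d a m S \<longrightarrow>
              favored_prior d r m S extreme_point_of ratio_class d r \<and>
              (r * (std_disc \<sigma> Y d a)\<^sup>2 + (\<Sum>j=1..m. sq_disc_desc \<sigma> Y d a j)) / (r + real m) =
                (\<Sum>k\<in>UNIV. favored_prior d r m S $ k * (std_disc \<sigma> Y k a)\<^sup>2))) \<and>
    (\<exists>l. is_arg_max (prior_value \<sigma> Y) (\<lambda>l. l \<in> ratio_class d r) l) \<and>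
    (\<forall>l. is_arg_max (prior_value \<sigma> Y) (\<lambda>l. l \<in> ratio_class d r) l \<longrightarrow>
         optimal_headline \<sigma> Y (ratio_class d r) = prior_headline \<sigma> Y l \<and>
         optimized_risk \<sigma> Y (ratio_class d r) = prior_value \<sigma> Y l + 1) \<and>
    antimono_on {1..} (\<lambda>s. optimized_risk \<sigma> Y (ratio_class d s)) \<and>
    ((\<lambda>s. optimized_risk \<sigma> Y (ratio_class d s)) \<longlongrightarrow> 1) at_top \<and>
    ((\<lambda>s. optimal_headline \<sigma> Y (ratio_class d s)) \<longlongrightarrow> Y $ d) at_top \<and>
    (CARD('n) = 2 \<longrightarrow>
      (\<forall>e. e \<noteq> d \<longrightarrow>
        (let p_r = r / (r + 1);
             p_\<Delta> = \<sigma> $ d / (\<sigma> $ d + \<sigma> $ e);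
             I_r = {p_r..1};
             p = max p_\<Delta> p_r
         in (\<forall>q. is_arg_min (\<lambda>q. \<bar>q - p_\<Delta>\<bar>) (\<lambda>q. q \<in> I_r) q \<longleftrightarrow> q = p) \<and>
            optimal_headline \<sigma> Y (ratio_class d r) =
              (p * Y $ d / (\<sigma> $ d)\<^sup>2 + (1 - p) * Y $ e / (\<sigma> $ e)\<^sup>2) /
              (p / (\<sigma> $ d)\<^sup>2 + (1 - p) / (\<sigma> $ e)\<^sup>2) \<and>
            optimized_risk \<sigma> Y (ratio_class d r) =
              p * (1 - p) * (Y $ d - Y $ e)\<^sup>2 /
              (p * (\<sigma> $ e)\<^sup>2 + (1 - p) * (\<sigma> $ d)\<^sup>2) + 1 \<and>
            (p_\<Delta> \<in> I_r \<longrightarrow>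
              optimal_headline \<sigma> Y (ratio_class d r) = optimal_headline \<sigma> Y prob_simplex) \<and>
            (p_\<Delta> \<in> I_r \<longleftrightarrow> r \<le> \<sigma> $ d / \<sigma> $ e) \<and>
            (r \<le> \<sigma> $ d / \<sigma> $ e \<longrightarrow>
              optimal_headline \<sigma> Y (ratio_class d r) = optimal_headline \<sigma> Y prob_simplex))))"
proof (intro conjI allI ballI impI)
  have pos: "\<And>k. \<sigma> $ k > 0" using \<sigma>_pos by blast
  note rc = compact_ratio_class ratio_class_nonempty ratio_class_subset
  show "is_arg_min (worst_case_risk \<sigma> Y (ratio_class d r)) (\<lambda>_. True) a \<longleftrightarrow>
      a = optimal_headline \<sigma> Y (ratio_class d r)" for a
    by (rule optimal_headline_unique[OF rc pos])
  show "worst_case_risk \<sigma> Y (ratio_class d r) a =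
      Max ((\<lambda>m. (r * (std_disc \<sigma> Y d a)\<^sup>2 + (\<Sum>j=1..m. sq_disc_desc \<sigma> Y d a j)) / (r + real m))
           ` {0..CARD('n) - 1}) + 1" for a
    by (rule worst_case_risk_ratio_class[OF r])
  show "\<exists>S. top_alternatives \<sigma> Y d a m S" if "m \<in> {0..CARD('n) - 1}" for a m
    using that by (intro top_alternatives_exist) simp
  show "favored_prior d r m S extreme_point_of ratio_class d r"
    "(r * (std_disc \<sigma> Y d a)\<^sup>2 + (\<Sum>j=1..m. sq_disc_desc \<sigma> Y d a j)) / (r + real m) =
      (\<Sum>k\<in>UNIV. favored_prior d r m S $ k * (std_disc \<sigma> Y k a)\<^sup>2)"
    if S: "top_alternatives \<sigma> Y d a m S" for a m S
  proof -
    have "d \<notin> S" "card S = m" using S by (auto simp: top_alternatives_def)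
    then show "favored_prior d r m S extreme_point_of ratio_class d r"
      using r by (rule favored_prior_extreme_point)
    show "(r * (std_disc \<sigma> Y d a)\<^sup>2 + (\<Sum>j=1..m. sq_disc_desc \<sigma> Y d a j)) / (r + real m) =
      (\<Sum>k\<in>UNIV. favored_prior d r m S $ k * (std_disc \<sigma> Y k a)\<^sup>2)"
      unfolding favored_prior_loss[OF \<open>d \<notin> S\<close>] sum_sq_disc_desc[OF S] ..
  qed
  show "\<exists>l. is_arg_max (prior_value \<sigma> Y) (\<lambda>l. l \<in> ratio_class d r) l"
    by (rule prior_value_attains_max[OF rc pos])
  show "optimal_headline \<sigma> Y (ratio_class d r) = prior_headline \<sigma> Y l"
    "optimized_risk \<sigma> Y (ratio_class d r) = prior_value \<sigma> Y l + 1"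
    if "is_arg_max (prior_value \<sigma> Y) (\<lambda>l. l \<in> ratio_class d r) l" for l
    using optimal_headline_prior_value_max[OF convex_ratio_class rc(1,3) pos that] by simp_all
  show "antimono_on {1..} (\<lambda>s. optimized_risk \<sigma> Y (ratio_class d s))"
    by (intro monotone_onI optimized_risk_mono ratio_class_antimono rc pos)
  show "((\<lambda>s. optimized_risk \<sigma> Y (ratio_class d s)) \<longlongrightarrow> 1) at_top"
    by (rule optimized_risk_tendsto[OF pos])
  show "((\<lambda>s. optimal_headline \<sigma> Y (ratio_class d s)) \<longlongrightarrow> Y $ d) at_top"
    by (rule optimal_headline_tendsto[OF pos])
  fix e assume n: "CARD('n) = 2" "e \<noteq> d"
  define p0 where "p0 = \<sigma> $ d / (\<sigma> $ d + \<sigma> $ e)"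
  define pr where "pr = r / (r + 1)"
  define p where "p = max p0 pr"
  have p0: "0 \<le> p0" "p0 \<le> 1" using pos[of d] pos[of e] by (simp_all add: p0_def)
  have pr: "0 \<le> pr" "pr \<le> 1" using r by (simp_all add: pr_def)
  have p: "0 \<le> p" "p \<le> 1" using p0 pr by (auto simp: p_def)
  have "(\<chi> k. if k = d then p else 1 - p) \<in> ratio_class d r"
    using two_design_ratio_class_iff[OF n r] two_design_prior_in_simplex[OF n p]
    by (simp add: p_def pr_def)
  \<comment> \<open>If p_\<Delta> attains the maximum, the first case holds; otherwise
    \<open>p\<close> is p_r, the lower bound on the favored weight throughout the class.\<close>
  moreover have "p = \<sigma> $ d / (\<sigma> $ d + \<sigma> $ e) \<or>
      \<sigma> $ d / (\<sigma> $ d + \<sigma> $ e) \<le> p \<and> (\<forall>l\<in>ratio_class d r. p \<le> l $ d)"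
    using two_design_ratio_class_iff[OF n r] by (auto simp: p_def max_def p0_def pr_def)
  ultimately have sol: "optimal_headline \<sigma> Y (ratio_class d r) =
      (p * Y $ d / (\<sigma> $ d)\<^sup>2 + (1 - p) * Y $ e / (\<sigma> $ e)\<^sup>2) / (p / (\<sigma> $ d)\<^sup>2 + (1 - p) / (\<sigma> $ e)\<^sup>2)"
    "optimized_risk \<sigma> Y (ratio_class d r) =
      p * (1 - p) * (Y $ d - Y $ e)\<^sup>2 / (p * (\<sigma> $ e)\<^sup>2 + (1 - p) * (\<sigma> $ d)\<^sup>2) + 1"
    using two_design_optimum[OF n pos convex_ratio_class rc(1,3) p] by blast+
  have sol0: "optimal_headline \<sigma> Y prob_simplex =
      (p0 * Y $ d / (\<sigma> $ d)\<^sup>2 + (1 - p0) * Y $ e / (\<sigma> $ e)\<^sup>2) / (p0 / (\<sigma> $ d)\<^sup>2 + (1 - p0) / (\<sigma> $ e)\<^sup>2)"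
    using two_design_optimum(1)[OF n pos convex_prob_simplex compact_prob_simplex order_refl p0
        two_design_prior_in_simplex[OF n p0]]
    by (simp add: p0_def)
  \<comment> \<open>Here \<open>p\<close> equals \<open>p0\<close>, so both headlines are given by
    the same formula.\<close>
  have same: "optimal_headline \<sigma> Y (ratio_class d r) = optimal_headline \<sigma> Y prob_simplex" if "pr \<le> p0"
    using sol(1) sol0 that by (simp add: p_def max_absorb1)
  have iff: "pr \<le> p0 \<longleftrightarrow> r \<le> \<sigma> $ d / \<sigma> $ e"
    using r pos[of d] pos[of e] by (simp add: pr_def p0_def field_simps)
  have mem: "p0 \<in> {pr..1} \<longleftrightarrow> r \<le> \<sigma> $ d / \<sigma> $ e"
    using iff p0(2) by simp
  have proj: "is_arg_min (\<lambda>q. \<bar>q - p0\<bar>) (\<lambda>q. q \<in> {pr..1}) q \<longleftrightarrow> q = p" for q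
    unfolding p_def by (rule is_arg_min_dist_Icc[OF pr(2) p0(2)])
  show "let p_r = r / (r + 1);
             p_\<Delta> = \<sigma> $ d / (\<sigma> $ d + \<sigma> $ e);
             I_r = {p_r..1};
             p = max p_\<Delta> p_r
         in (\<forall>q. is_arg_min (\<lambda>q. \<bar>q - p_\<Delta>\<bar>) (\<lambda>q. q \<in> I_r) q \<longleftrightarrow> q = p) \<and>
            optimal_headline \<sigma> Y (ratio_class d r) =
              (p * Y $ d / (\<sigma> $ d)\<^sup>2 + (1 - p) * Y $ e / (\<sigma> $ e)\<^sup>2) /
              (p / (\<sigma> $ d)\<^sup>2 + (1 - p) / (\<sigma> $ e)\<^sup>2) \<and>
            optimized_risk \<sigma> Y (ratio_class d r) =
              p * (1 - p) * (Y $ d - Y $ e)\<^sup>2 /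
              (p * (\<sigma> $ e)\<^sup>2 + (1 - p) * (\<sigma> $ d)\<^sup>2) + 1 \<and>
            (p_\<Delta> \<in> I_r \<longrightarrow>
              optimal_headline \<sigma> Y (ratio_class d r) = optimal_headline \<sigma> Y prob_simplex) \<and>
            (p_\<Delta> \<in> I_r \<longleftrightarrow> r \<le> \<sigma> $ d / \<sigma> $ e) \<and>
            (r \<le> \<sigma> $ d / \<sigma> $ e \<longrightarrow>
              optimal_headline \<sigma> Y (ratio_class d r) = optimal_headline \<sigma> Y prob_simplex)"
    unfolding Let_def p0_def[symmetric] pr_def[symmetric] p_def[symmetric] mem
    by (intro conjI allI impI proj sol same[unfolded iff] refl)
qed

end
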